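(* Fix any $p\in[1,\infty)$, consider a sequence of positive scalars $\{w_k\}_{k=1}^\infty$, and let $\{\delta_k\}_{k=1}^\infty$ denote the canonical unit basis for $\ell^p_w$. Let $e_k:=w_k^{-1/p}\,\delta_k$, $k\in\mathbb N$. Then $\{e_k\}_{k=1}^\infty$ is a $p$-Riesz basis for $\ell^p_w$ with bounds $A=B=1$. In particular, the left/right-shift operators $L,R$ with respect to the basis $\{e_k\}_{k=1}^\infty$ are bounded, and $\|L\|=\|R\|=1$.
   Context: $\ell^p_w:=\{\{c_k\}_{k=1}^\infty : c_k\in\mathbb C,\ \sum_{k=1}^\infty|c_k|^pw_k<\infty\}$, a Banach space with the norm $\|\{c_k\}_{k=1}^\infty\|_{p,w}:=\left(\sum_{k=1}^\infty|c_k|^pw_k\right)^{1/p}$. The vector $\delta_k$ is the sequence with $1$ in position $k$ and $0$ elsewhere. A sequence $\{e_k\}_{k=1}^\infty$ in a Banach space $X$ is a $p$-Riesz basis for $X$ with bounds $A,B>0$ if the closed linear span of $\{e_k\}_{k=1}^\infty$ is $X$ and $A\left(\sum_{k=1}^N|c_k|^p\right)^{1/p}\le\left\|\sum_{k=1}^Nc_ke_k\right\|\le B\left(\sum_{k=1}^N|c_k|^p\right)^{1/p}$ for all finite scalar sequences $\{c_k\}_{k=1}^N$, $N\in\mathbb N$. The left-shift and right-shift operators with respect to $\{e_k\}_{k=1}^\infty$ are the linear maps $L,R:\mathrm{span}\{e_k\}_{k=1}^\infty\to X$ given by $Le_1=0$, $Le_k=e_{k-1}$ ($k\ge2$), and $Re_k=e_{k+1}$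 ($k\in\mathbb N$); "bounded" means that they extend to bounded linear operators on $X$, and the norms refer to these extensions. *)

theory Defs
  imports "HOL-Analysis.Analysis" "HOL-Library.Function_Algebras"
begin

text \<open>
  The weight is a term parameter of the weighted sequence space, so the space is a carrier set
  \<open>V\<close> with a norm \<open>nrm\<close>, inside an ambient complex vector space given by its scalar
  multiplication. Nothing is assumed about \<open>nrm\<close> outside \<open>V\<close>.
\<close>

locale complex_normed_space = vector_space scale
  for scale :: "complex \<Rightarrow> 'a::ab_group_add \<Rightarrow> 'a" (infixr \<open>*s\<close> 75) +
  fixes V :: "'a set" and nrm :: "'a \<Rightarrow> real"
  assumes subspace_carrier: "subspace V"
    and nrm_nonneg: "x \<in> V \<Longrightarrow> 0 \<le> nrm x"
    and nrm_eq_0_iff: "x \<in> V \<Longrightarrow> nrm x = 0 \<longleftrightarrow> x = 0"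
    and nrm_triangle: "x \<in> V \<Longrightarrow> y \<in> V \<Longrightarrow> nrm (x + y) \<le> nrm x + nrm y"
    and nrm_scale: "x \<in> V \<Longrightarrow> nrm (c *s x) = norm c * nrm x"
begin

text \<open>
  \<^locale>\<open>Metric_space\<close> demands nonnegativity and symmetry at all points, also outside the
  carrier, hence the case distinction.
\<close>

definition ndist :: "'a \<Rightarrow> 'a \<Rightarrow> real" where
  "ndist x y = (if x \<in> V \<and> y \<in> V then nrm (x - y) else 0)"

sublocale metric: Metric_space V ndist
proof
  show "0 \<le> ndist x y" for x y
    by (simp add: ndist_def nrm_nonneg subspace_diff[OF subspace_carrier])
  show "ndist x y = ndist y x" for x y
  proof (cases "x \<in> V \<and> y \<in> V")
    case True
    then have "nrm ((-1) *s (x - y)) = norm (-1 :: complex) * nrm (x - y)"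
      by (intro nrm_scale subspace_diff[OF subspace_carrier]) auto
    then have "nrm (y - x) = nrm (x - y)"
      by (simp add: scale_minus_left)
    with True show ?thesis by (simp add: ndist_def)
  qed (auto simp: ndist_def)
  show "(ndist x y = 0) = (x = y)" if "x \<in> V" "y \<in> V" for x y
    using that by (simp add: ndist_def nrm_eq_0_iff subspace_diff[OF subspace_carrier])
  show "ndist x z \<le> ndist x y + ndist y z" if "x \<in> V" "y \<in> V" "z \<in> V" for x y z
    using that nrm_triangle[of "x - y" "y - z"]
    by (simp add: ndist_def subspace_diff[OF subspace_carrier])
qed

definition linear_map_on :: "'a set \<Rightarrow> ('a \<Rightarrow> 'a) \<Rightarrow> bool" where
  "linear_map_on S T \<longleftrightarrow>
     (\<forall>x\<in>S. T x \<in> V) \<and>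
     (\<forall>x\<in>S. \<forall>y\<in>S. T (x + y) = T x + T y) \<and>
     (\<forall>c. \<forall>x\<in>S. T (c *s x) = c *s T x)"

definition bounded_operator :: "('a \<Rightarrow> 'a) \<Rightarrow> bool" where
  "bounded_operator T \<longleftrightarrow> linear_map_on V T \<and> (\<exists>K. \<forall>x\<in>V. nrm (T x) \<le> K * nrm x)"

definition operator_norm :: "('a \<Rightarrow> 'a) \<Rightarrow> real" where
  "operator_norm T = (SUP x\<in>{x \<in> V. nrm x \<le> 1}. nrm (T x))"

definition bounded_extension :: "'a set \<Rightarrow> ('a \<Rightarrow> 'a) \<Rightarrow> ('a \<Rightarrow> 'a) \<Rightarrow> bool" where
  "bounded_extension S L T \<longleftrightarrow> bounded_operator T \<and> (\<forall>x\<in>S. T x = L x)"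

text \<open>
  \<open>L\<close>, given on \<open>S\<close>, extends to a bounded operator on \<open>V\<close>, and such an extension has norm
  \<open>r\<close>. Extensions may differ off \<open>V\<close>, and for a dense subspace \<open>S\<close> only there.
\<close>

definition extends_boundedly_with_norm :: "'a set \<Rightarrow> ('a \<Rightarrow> 'a) \<Rightarrow> real \<Rightarrow> bool" where
  "extends_boundedly_with_norm S L r \<longleftrightarrow>
     (\<exists>T. bounded_extension S L T) \<and>
     (\<forall>T. bounded_extension S L T \<longrightarrow> operator_norm T = r)"

text \<open>
  Sequences are indexed from 0, so \<open>e 0\<close> is the first vector. The shifts are linear maps on the
  algebraic span only; the values of \<open>L\<close> and \<open>R\<close> elsewhere are irrelevant.
\<close>

definition is_left_shift :: "(nat \<Rightarrow> 'a) \<Rightarrow> ('a \<Rightarrow> 'a) \<Rightarrow> bool" where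
  "is_left_shift e L \<longleftrightarrow>
     linear_map_on (span (range e)) L \<and> L (e 0) = 0 \<and> (\<forall>k. L (e (Suc k)) = e k)"

definition is_right_shift :: "(nat \<Rightarrow> 'a) \<Rightarrow> ('a \<Rightarrow> 'a) \<Rightarrow> bool" where
  "is_right_shift e R \<longleftrightarrow>
     linear_map_on (span (range e)) R \<and> (\<forall>k. R (e k) = e (Suc k))"

end

locale complex_banach_space = complex_normed_space +
  assumes complete: "metric.mcomplete"

locale p_riesz_basis = complex_banach_space scale V nrm
  for scale :: "complex \<Rightarrow> 'a::ab_group_add \<Rightarrow> 'a" (infixr \<open>*s\<close> 75) and V nrm +
  fixes p :: real and e :: "nat \<Rightarrow> 'a" and A B :: real
  assumes p_ge_1: "1 \<le> p"
    and in_carrier: "e k \<in> V"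
    and A_pos: "0 < A" and B_pos: "0 < B"
    and closed_span: "metric.mtopology closure_of (span (range e)) = V"
    and lower_bound:
      "A * (\<Sum>k<N. norm (c k) powr p) powr (1 / p) \<le> nrm (\<Sum>k<N. c k *s e k)"
    and upper_bound:
      "nrm (\<Sum>k<N. c k *s e k) \<le> B * (\<Sum>k<N. norm (c k) powr p) powr (1 / p)"

definition seq_scale :: "complex \<Rightarrow> (nat \<Rightarrow> complex) \<Rightarrow> nat \<Rightarrow> complex" where
  "seq_scale a c = (\<lambda>k. a * c k)"

definition weighted_lp :: "real \<Rightarrow> (nat \<Rightarrow> real) \<Rightarrow> (nat \<Rightarrow> complex) set" where
  "weighted_lp p w = {c. summable (\<lambda>k. norm (c k) powr p * w k)}"

definition weighted_lp_norm :: "real \<Rightarrow> (nat \<Rightarrow> real) \<Rightarrow> (nat \<Rightarrow> complex) \<Rightarrow> real" where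
  "weighted_lp_norm p w c = (\<Sum>k. norm (c k) powr p * w k) powr (1 / p)"

definition delta :: "nat \<Rightarrow> nat \<Rightarrow> complex" where
  "delta k = (\<lambda>j. if j = k then 1 else 0)"

end

theory Submission imports Defs begin

text \<open>
  In the coordinates \<open>w k powr (1 / p) * c k\<close> the weighted norm is the plain \<open>\<ell>\<^sup>p\<close> norm and
  \<open>e\<close> is the canonical basis, so both shifts have explicit norm-one extensions to the whole
  space. Since the span of \<open>e\<close> is dense, every bounded extension coincides with the explicit one
  on the carrier.
\<close>

section \<open>Density and uniqueness of bounded extensions in a normed space\<close>

context complex_normed_space
begin

lemma closure_of_eq_carrier_iff:
  assumes "S \<subseteq> V"
  shows "metric.mtopology closure_of S = V \<longleftrightarrow> (\<forall>x\<in>V. \<forall>r>0. \<exists>y\<in>S. nrm (x - y) < r)"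
proof -
  have "metric.mtopology closure_of S = {x \<in> V. \<forall>r>0. \<exists>y\<in>S. nrm (x - y) < r}"
    using assms by (force simp: metric.metric_closure_of metric.in_mball ndist_def)
  then show ?thesis by (simp add: set_eq_iff) blast
qed

lemma linear_map_on_diff:
  assumes "linear_map_on S T" "subspace S" "x \<in> S" "y \<in> S"
  shows "T (x - y) = T x - T y"
proof -
  have "T (x + (-1) *s y) = T x + (-1) *s T y"
    using assms subspace_scale[OF assms(2,4)] unfolding linear_map_on_def by metis
  then show ?thesis by (simp add: scale_minus_left)
qed

text \<open>The points of \<open>span B\<close> where the two maps agree form a subspace containing
  \<open>B\<close>, hence all of \<open>span B\<close>.\<close>

lemma linear_map_on_eq_on_span:
  assumes "linear_map_on (span B) S" "linear_map_on (span B) T"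
    and "\<And>b. b \<in> B \<Longrightarrow> S b = T b" and "x \<in> span B"
  shows "S x = T x"
proof -
  have "0 \<in> span B" by (rule span_zero)
  \<comment> \<open>Homogeneity with the scalar 0 yields \<open>S 0 = 0\<close> and
    \<open>T 0 = 0\<close>, so the agreement set contains 0.\<close>
  then have "S (0 *s 0) = 0 *s S 0" "T (0 *s 0) = 0 *s T 0"
    using assms(1,2) unfolding linear_map_on_def by blast+
  then have "subspace {x \<in> span B. S x = T x}"
    using assms(1,2) span_zero
    by (auto intro!: subspaceI simp: linear_map_on_def span_add span_scale)
  then have "span B \<subseteq> {x \<in> span B. S x = T x}"
    using assms(3) by (intro span_minimal) (auto intro: span_base)
  then show ?thesis using assms(4) by blast
qed

lemma linear_map_on_subset:
  "linear_map_on S T \<Longrightarrow> S' \<subseteq> S \<Longrightarrow> linear_map_on S' T"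
  unfolding linear_map_on_def by blast

text \<open>Bounded operators are continuous: approximating \<open>x\<close> by points
  \<open>y\<close> of the dense set, where \<open>T\<close> and \<open>T'\<close> agree, makes
  \<open>nrm (T x - T' x)\<close> arbitrarily small.\<close>

lemma bounded_operator_eq_on_closure:
  assumes "bounded_operator T" "bounded_operator T'"
    and "S \<subseteq> V" "metric.mtopology closure_of S = V"
    and "\<And>x. x \<in> S \<Longrightarrow> T x = T' x" and x: "x \<in> V"
  shows "T x = T' x"
proof -
  note V = subspace_carrier
  obtain K K' where K: "\<And>x. x \<in> V \<Longrightarrow> nrm (T x) \<le> K * nrm x"
    and K': "\<And>x. x \<in> V \<Longrightarrow> nrm (T' x) \<le> K' * nrm x"
    using assms(1,2) unfolding bounded_operator_def by blast
  have lin: "linear_map_on V T" "linear_map_on V T'"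
    using assms(1,2) unfolding bounded_operator_def by blast+
  then have TV: "T y \<in> V" "T' y \<in> V" if "y \<in> V" for y
    using that unfolding linear_map_on_def by blast+
  \<comment> \<open>The constants \<open>K\<close> and \<open>K'\<close> may be negative, hence the
    absolute values; the summand 1 makes \<open>C\<close> positive, so that \<epsilon> can be
    divided by it.\<close>
  define C where "C = \<bar>K\<bar> + \<bar>K'\<bar> + 1"
  have C: "C > 0" by (simp add: C_def)
  have "nrm (T x - T' x) \<le> 0 + \<epsilon>" if "\<epsilon> > 0" for \<epsilon>
  proof -
    obtain y where y: "y \<in> S" "nrm (x - y) < \<epsilon> / C"
      using assms(4) closure_of_eq_carrier_iff[OF assms(3)] x \<open>C > 0\<close> \<open>\<epsilon> > 0\<close>
      by (metis divide_pos_pos)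
    then have yV: "y \<in> V" using assms(3) by blast
    have d: "x - y \<in> V" "y - x \<in> V" using V x yV by (auto intro: subspace_diff)
    have sym: "nrm (y - x) = nrm (x - y)"
      using metric.commute[of x y] x yV by (simp add: ndist_def)
    \<comment> \<open>The terms \<open>T y\<close> and \<open>T' y\<close> cancel. Reversing the
      second difference gives a sum, to which \<open>nrm_triangle\<close> applies.\<close>
    have "T x - T' x = T (x - y) + T' (y - x)"
      using linear_map_on_diff[OF lin(1) V x yV] linear_map_on_diff[OF lin(2) V yV x]
        assms(5)[OF y(1)] by simp
    then have "nrm (T x - T' x) \<le> nrm (T (x - y)) + nrm (T' (y - x))"
      using nrm_triangle TV d by metis
    also have "\<dots> \<le> K * nrm (x - y) + K' * nrm (x - y)"
      using K[OF d(1)] K'[OF d(2)] sym by simp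
    also have "\<dots> \<le> C * nrm (x - y)"
      unfolding C_def distrib_right[symmetric]
      by (rule mult_right_mono) (use nrm_nonneg[OF d(1)] in auto)
    also have "\<dots> \<le> \<epsilon>" using y(2) C by (simp add: field_simps)
    finally show ?thesis by simp
  qed
  then have "nrm (T x - T' x) \<le> 0" by (rule field_le_epsilon)
  moreover have "T x - T' x \<in> V" using TV[OF x] V by (auto intro: subspace_diff)
  ultimately show ?thesis
    using nrm_nonneg nrm_eq_0_iff by (metis antisym eq_iff_diff_eq_0)
qed

text \<open>One explicit extension suffices: by density any other one agrees with it on
  \<open>V\<close>, and \<open>operator_norm\<close> sees only the values on
  \<open>V\<close>.\<close>

lemma extends_boundedly_with_normI:
  assumes "bounded_operator T" "\<And>x. x \<in> S \<Longrightarrow> T x = L x" "operator_norm T = r"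
    and "S \<subseteq> V" "metric.mtopology closure_of S = V"
  shows "extends_boundedly_with_norm S L r"
  unfolding extends_boundedly_with_norm_def
proof (intro conjI allI impI)
  show "\<exists>T. bounded_extension S L T"
    using assms(1,2) unfolding bounded_extension_def by blast
  fix T' assume T': "bounded_extension S L T'"
  have "T' x = T x" if "x \<in> V" for x
    by (rule bounded_operator_eq_on_closure[OF _ assms(1,4,5) _ that])
      (use T' assms(2) in \<open>auto simp: bounded_extension_def\<close>)
  then have "operator_norm T' = operator_norm T"
    unfolding operator_norm_def by (intro SUP_cong) auto
  then show "operator_norm T' = r" using assms(3) by simp
qed

lemma operator_norm_eq_1:
  assumes "\<And>x. x \<in> V \<Longrightarrow> nrm (T x) \<le> nrm x"
    and "x \<in> V" "nrm x = 1" "nrm (T x) = 1"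
  shows "operator_norm T = 1"
  unfolding operator_norm_def
proof (rule cSup_eq_maximum)
  show "1 \<in> (\<lambda>x. nrm (T x)) ` {x \<in> V. nrm x \<le> 1}"
    using assms(2-4) by (intro image_eqI[of _ _ x]) auto
  show "y \<le> 1" if "y \<in> (\<lambda>x. nrm (T x)) ` {x \<in> V. nrm x \<le> 1}" for y
    using that assms(1) by force
qed

end

section \<open>The vector space of sequences and the convexity of powers\<close>

lemma sum_fun_apply: "sum f S k = (\<Sum>i\<in>S. f i k)"
  for f :: "'i \<Rightarrow> 'a \<Rightarrow> 'b::comm_monoid_add"
  by (induction S rule: infinite_finite_induct) auto

interpretation seq: vector_space seq_scale
  by unfold_locales (auto simp: seq_scale_def fun_eq_iff algebra_simps)

text \<open>For positive points this is \<open>powr_convex\<close>. If one point is 0, the claim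
  reduces to \<open>s powr p \<le> s\<close> for the weight \<open>s\<close> of the other point,
  which holds because \<open>p\<close> is at least 1.\<close>

lemma powr_convex_nonneg:
  fixes p :: real
  assumes "1 \<le> p"
  shows "convex_on {0..} (\<lambda>x. x powr p)"
proof (rule convex_onI)
  fix t x y :: real
  assume t: "0 < t" "t < 1" and xy: "x \<in> {0..}" "y \<in> {0..}"
  have le: "s powr p \<le> s" if "0 < s" "s < 1" for s :: real
    using powr_mono'[of 1 p s] that assms by simp
  show "((1 - t) *\<^sub>R x + t *\<^sub>R y) powr p \<le> (1 - t) * x powr p + t * y powr p"
  proof (cases "0 < x \<and> 0 < y")
    case True
    then show ?thesis using convex_onD[OF powr_convex[OF assms], of t x y] t by simp
  next
    case False
    then have "x = 0 \<or> y = 0" using xy by auto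
    then show ?thesis
      using t xy le[of t] le[of "1 - t"] by (auto simp: powr_mult intro!: mult_right_mono)
  qed
qed simp

text \<open>The pointwise form of Minkowski's inequality: after the triangle inequality, the
  quotient by \<open>a + b\<close> is a convex combination of \<open>norm x / a\<close> and
  \<open>norm y / b\<close> with weights \<open>a / (a + b)\<close> and
  \<open>b / (a + b)\<close>.\<close>

lemma norm_add_powr_le:
  fixes x y :: "'a::real_normed_vector"
  assumes "1 \<le> p" "0 < a" "0 < b"
  shows "norm (x + y) powr p / (a + b) powr p \<le>
    a / (a + b) * (norm x powr p / a powr p) + b / (a + b) * (norm y powr p / b powr p)"
proof -
  have conv: "convex_on {0..} (\<lambda>x::real. x powr p)"
    using powr_convex_nonneg[OF assms(1)] .
  have "norm (x + y) \<le> norm x + norm y" by (rule norm_triangle_ineq)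
  then have "norm (x + y) powr p / (a + b) powr p \<le> ((norm x + norm y) / (a + b)) powr p"
    using assms by (simp add: powr_divide divide_right_mono powr_mono2)
  also have "(norm x + norm y) / (a + b) =
      a / (a + b) * (norm x / a) + b / (a + b) * (norm y / b)"
    using assms by (simp add: add_divide_distrib)
  also have "\<dots> powr p \<le> a / (a + b) * (norm x / a) powr p + b / (a + b) * (norm y / b) powr p"
    using convex_onD[OF conv, of "b / (a + b)" "norm x / a" "norm y / b"] assms
    by (simp add: field_simps)
  finally show ?thesis using assms by (simp add: powr_divide)
qed

section \<open>The weighted space and its norm\<close>

locale weighted_lp_space =
  fixes p :: real and w :: "nat \<Rightarrow> real"
  assumes p: "1 \<le> p" and w: "\<And>k. 0 < w k"
begin

abbreviation "V \<equiv> weighted_lp p w"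
abbreviation "nrm \<equiv> weighted_lp_norm p w"

lemma p_pos: "0 < p" using p by simp

lemma term_nonneg [simp]: "0 \<le> norm (z :: complex) powr p * w k"
  using w[of k] by simp

lemma mem_iff: "c \<in> V \<longleftrightarrow> summable (\<lambda>k. norm (c k) powr p * w k)"
  by (simp add: weighted_lp_def)

lemma suminf_term_nonneg: "c \<in> V \<Longrightarrow> 0 \<le> (\<Sum>k. norm (c k) powr p * w k)"
  by (simp add: mem_iff suminf_nonneg)

lemma nrm_powr: "c \<in> V \<Longrightarrow> nrm c powr p = (\<Sum>k. norm (c k) powr p * w k)"
  using p_pos suminf_term_nonneg by (simp add: weighted_lp_norm_def powr_powr)

lemma nrm_ge_0: "0 \<le> nrm c"
  by (simp add: weighted_lp_norm_def)

text \<open>A uniform bound on partial sums gives membership and a norm estimate at once. The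
  triangle inequality, completeness, density and the bounds for the shifts all go through
  it.\<close>

lemma nrm_leI:
  assumes "0 \<le> r" "\<And>n. (\<Sum>k<n. norm (c k) powr p * w k) \<le> r powr p"
  shows "c \<in> V" "nrm c \<le> r"
proof -
  \<comment> \<open>The summability criterion bounds sums up to and including \<open>n\<close>,
    hence the instance at \<open>Suc\<close>.\<close>
  show "c \<in> V" unfolding mem_iff
    by (rule bounded_imp_summable[where B = "r powr p"])
      (use assms(2)[of "Suc _"] in \<open>auto simp: lessThan_Suc_atMost\<close>)
  then have "nrm c powr p \<le> r powr p"
    unfolding nrm_powr[OF \<open>c \<in> V\<close>] by (intro suminf_le_const assms) (simp add: mem_iff)
  then show "nrm c \<le> r"
    using p_pos assms(1) nrm_ge_0 by (meson not_le powr_less_mono2)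
qed

lemma sum_term_le_nrm:
  assumes "c \<in> V" "finite K"
  shows "(\<Sum>k\<in>K. norm (c k) powr p * w k) \<le> nrm c powr p"
  unfolding nrm_powr[OF assms(1)]
  by (rule sum_le_suminf) (use assms in \<open>auto simp: mem_iff\<close>)

text \<open>A single term is bounded by the whole series. This makes the coordinates continuous,
  which yields definiteness of the norm and, later, coordinatewise limits of Cauchy
  sequences.\<close>

lemma norm_coord_le:
  assumes "c \<in> V"
  shows "norm (c k) \<le> w k powr (-1 / p) * nrm c"
proof -
  have "norm (c k) powr p \<le> nrm c powr p / w k"
    using sum_term_le_nrm[OF assms, of "{k}"] w[of k] by (simp add: field_simps)
  also have "\<dots> = (w k powr (-1 / p) * nrm c) powr p"
    using w[of k] p_pos nrm_ge_0[of c]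
    by (simp add: powr_mult powr_divide powr_powr powr_minus_divide)
  finally show ?thesis
    using p_pos nrm_ge_0 by (meson not_le powr_less_mono2 norm_ge_zero mult_nonneg_nonneg powr_ge_zero)
qed

lemma nrm_eq_0_iff: "c \<in> V \<Longrightarrow> nrm c = 0 \<longleftrightarrow> c = 0"
  using norm_coord_le[of c] by (force simp: weighted_lp_norm_def)

lemma scale_in_carrier: "c \<in> V \<Longrightarrow> seq_scale a c \<in> V"
  using summable_mult[of "\<lambda>k. norm (c k) powr p * w k" "norm a powr p"]
  by (simp add: mem_iff seq_scale_def norm_mult powr_mult mult.assoc)

lemma nrm_scale:
  assumes "c \<in> V"
  shows "nrm (seq_scale a c) = norm a * nrm c"
proof -
  have "(\<Sum>k. norm (seq_scale a c k) powr p * w k) = norm a powr p * (\<Sum>k. norm (c k) powr p * w k)"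
    using assms suminf_mult[of "\<lambda>k. norm (c k) powr p * w k" "norm a powr p"]
    by (simp add: mem_iff seq_scale_def norm_mult powr_mult mult.assoc)
  then show ?thesis
    using p_pos suminf_term_nonneg[OF assms] by (simp add: weighted_lp_norm_def powr_mult powr_powr)
qed

text \<open>For positive \<open>a\<close> and \<open>b\<close> dominating the two norms, the
  inequality \<open>norm_add_powr_le\<close> is summed against the weights; both normalised sums are
  at most 1, so the convex combination is too.\<close>

lemma
  assumes "x \<in> V" "y \<in> V"
  shows add_in_carrier: "x + y \<in> V" and nrm_triangle: "nrm (x + y) \<le> nrm x + nrm y"
proof -
  have *: "(\<Sum>k<n. norm ((x + y) k) powr p * w k) \<le> (a + b) powr p"
    if ab: "nrm x \<le> a" "nrm y \<le> b" "0 < a" "0 < b" for a b n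
  proof -
    have "(\<Sum>k<n. norm ((x + y) k) powr p * w k) / (a + b) powr p =
        (\<Sum>k<n. norm (x k + y k) powr p / (a + b) powr p * w k)"
      by (simp add: sum_divide_distrib)
    also have "\<dots> \<le> (\<Sum>k<n. (a / (a + b) * (norm (x k) powr p / a powr p)
        + b / (a + b) * (norm (y k) powr p / b powr p)) * w k)"
      by (intro sum_mono mult_right_mono norm_add_powr_le p ab less_imp_le[OF w])
    also have "\<dots> = a / (a + b) * ((\<Sum>k<n. norm (x k) powr p * w k) / a powr p)
        + b / (a + b) * ((\<Sum>k<n. norm (y k) powr p * w k) / b powr p)"
      by (simp add: sum_divide_distrib sum_distrib_left sum.distrib distrib_right mult.assoc)
    also have "\<dots> \<le> a / (a + b) * 1 + b / (a + b) * 1"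
    proof (intro add_mono mult_left_mono)
      have "(\<Sum>k<n. norm (x k) powr p * w k) \<le> a powr p"
        using sum_term_le_nrm[OF assms(1), of "{..<n}"] powr_mono2[OF _ nrm_ge_0 ab(1), of p] p_pos
        by simp
      then show "(\<Sum>k<n. norm (x k) powr p * w k) / a powr p \<le> 1" using ab by simp
      have "(\<Sum>k<n. norm (y k) powr p * w k) \<le> b powr p"
        using sum_term_le_nrm[OF assms(2), of "{..<n}"] powr_mono2[OF _ nrm_ge_0 ab(2), of p] p_pos
        by simp
      then show "(\<Sum>k<n. norm (y k) powr p * w k) / b powr p \<le> 1" using ab by simp
    qed (use ab in auto)
    also have "\<dots> = 1" using ab by (simp flip: add_divide_distrib)
    finally show ?thesis using ab by (simp add: field_simps)
  qed
  \<comment> \<open>The norms may vanish, so each is enlarged by \<epsilon>/2 to serve as a positive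
    divisor; \<epsilon> is then arbitrary.\<close>
  have **: "x + y \<in> V" "nrm (x + y) \<le> nrm x + nrm y + \<epsilon>" if "\<epsilon> > 0" for \<epsilon>
    using nrm_leI[of "(nrm x + \<epsilon>/2) + (nrm y + \<epsilon>/2)" "x + y"]
      *[of "nrm x + \<epsilon>/2" "nrm y + \<epsilon>/2"] nrm_ge_0[of x] nrm_ge_0[of y] that
    by (auto simp: add_pos_nonneg add_nonneg_pos)
  show "x + y \<in> V" using **(1)[of 1] by simp
  show "nrm (x + y) \<le> nrm x + nrm y" using **(2) by (rule field_le_epsilon)
qed

sublocale complex_normed_space seq_scale V nrm
proof unfold_locales
  show "seq.subspace V"
    by (rule seq.subspaceI)
      (auto simp: add_in_carrier scale_in_carrier, simp add: mem_iff)
qed (use nrm_ge_0 nrm_eq_0_iff nrm_triangle nrm_scale in auto)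

section \<open>Completeness\<close>

sublocale complex_banach_space seq_scale V nrm
proof unfold_locales
  show "metric.mcomplete"
    unfolding metric.mcomplete_def
  proof (intro allI impI)
    fix f assume "metric.MCauchy f"
    then have fV: "f n \<in> V" for n by (auto simp: metric.MCauchy_def)
    then have dV: "f n - f m \<in> V" for n m
      using subspace_carrier by (auto intro: seq.subspace_diff)
    have cauchy: "\<exists>N. \<forall>n m. N \<le> n \<longrightarrow> N \<le> m \<longrightarrow> nrm (f n - f m) < \<epsilon>" if "\<epsilon> > 0" for \<epsilon>
      using \<open>metric.MCauchy f\<close> that fV by (simp add: metric.MCauchy_def ndist_def)
    \<comment> \<open>Each coordinate is Cauchy by \<open>norm_coord_le\<close>; the coordinatewise
      limit \<open>g\<close> is the candidate for the limit in norm.\<close>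
    have "Cauchy (\<lambda>n. f n k)" for k
    proof (rule metric_CauchyI)
      fix \<epsilon> :: real assume "\<epsilon> > 0"
      then obtain N where N: "\<And>n m. N \<le> n \<Longrightarrow> N \<le> m \<Longrightarrow> nrm (f n - f m) < \<epsilon> / w k powr (-1 / p)"
        using cauchy[of "\<epsilon> / w k powr (-1 / p)"] w[of k] by auto
      have "dist (f m k) (f n k) < \<epsilon>" if "m \<ge> N" "n \<ge> N" for m n
      proof -
        have "dist (f m k) (f n k) \<le> w k powr (-1 / p) * nrm (f m - f n)"
          using norm_coord_le[OF dV, of m n k] by (simp add: dist_norm)
        also have "\<dots> < \<epsilon>" using N[OF that] w[of k] by (simp add: field_simps)
        finally show ?thesis .
      qed
      then show "\<exists>M. \<forall>m\<ge>M. \<forall>n\<ge>M. dist (f m k) (f n k) < \<epsilon>" by blast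
    qed
    then have "\<exists>l. (\<lambda>n. f n k) \<longlonglongrightarrow> l" for k
      using Cauchy_convergent convergent_def by blast
    then obtain g where g: "\<And>k. (\<lambda>n. f n k) \<longlonglongrightarrow> g k" by metis
    have lim: "\<exists>N. \<forall>n\<ge>N. f n - g \<in> V \<and> nrm (f n - g) \<le> \<epsilon>" if "\<epsilon> > 0" for \<epsilon>
    proof -
      obtain N where N: "\<And>n m. N \<le> n \<Longrightarrow> N \<le> m \<Longrightarrow> nrm (f n - f m) < \<epsilon>"
        using cauchy[of \<epsilon>] \<open>\<epsilon> > 0\<close> by blast
      \<comment> \<open>With \<open>n\<close> and \<open>K\<close> fixed, \<open>m\<close> tends to
        infinity: in a finite sum coordinatewise convergence suffices. The bound is independent of
        \<open>K\<close>, so \<open>nrm_leI\<close> applies afterwards.\<close>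
      have "(\<Sum>k<K. norm ((f n - g) k) powr p * w k) \<le> \<epsilon> powr p" if "n \<ge> N" for n K
      proof (rule LIMSEQ_le_const2)
        show "(\<lambda>m. \<Sum>k<K. norm ((f n - f m) k) powr p * w k)
            \<longlonglongrightarrow> (\<Sum>k<K. norm ((f n - g) k) powr p * w k)"
          using g p_pos by (auto intro!: tendsto_eq_intros simp: w)
        have "(\<Sum>k<K. norm ((f n - f m) k) powr p * w k) \<le> \<epsilon> powr p" if "m \<ge> N" for m
        proof -
          have "nrm (f n - f m) powr p \<le> \<epsilon> powr p"
            using N[OF \<open>n \<ge> N\<close> that] p_pos by (intro powr_mono2) (auto simp: nrm_ge_0)
          with sum_term_le_nrm[OF dV, of "{..<K}" n m] show ?thesis by simp
        qed
        then show "\<exists>N. \<forall>m\<ge>N. (\<Sum>k<K. norm ((f n - f m) k) powr p * w k) \<le> \<epsilon> powr p" by blast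
      qed
      then show ?thesis using nrm_leI[of \<epsilon>] \<open>\<epsilon> > 0\<close> by (meson less_imp_le)
    qed
    have "g \<in> V"
    proof -
      obtain n where "f n - g \<in> V" using lim[of 1] by auto
      \<comment> \<open>The limit lies in the space as the difference of two members.\<close>
      then have "f n - (f n - g) \<in> V"
        by (rule seq.subspace_diff[OF subspace_carrier fV])
      then show ?thesis by simp
    qed
    have "limitin metric.mtopology f g sequentially"
      unfolding metric.limit_metric_sequentially
    proof (intro conjI allI impI \<open>g \<in> V\<close>)
      fix \<epsilon> :: real assume "\<epsilon> > 0"
      \<comment> \<open>Passing to the limit left only a weak inequality; the bound \<epsilon>/2
        makes it strict.\<close>
      then show "\<exists>N. \<forall>n\<ge>N. f n \<in> V \<and> ndist (f n) g < \<epsilon>"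
        using lim[of "\<epsilon> / 2"] fV \<open>g \<in> V\<close> by (fastforce simp: ndist_def)
    qed
    then show "\<exists>x. limitin metric.mtopology f x sequentially" by blast
  qed
qed

section \<open>The normalised vectors \<open>unit k\<close>, which are the \<open>e k\<close> of the
  theorem, and the Riesz basis property\<close>

definition unit :: "nat \<Rightarrow> nat \<Rightarrow> complex" where
  "unit k = seq_scale (complex_of_real (w k powr (- 1 / p))) (delta k)"

lemma unit_apply: "unit k j = (if j = k then complex_of_real (w k powr (- 1 / p)) else 0)"
  by (simp add: unit_def seq_scale_def delta_def)

text \<open>The \<open>p\<close>-th power of the normalising factor is the inverse of
  \<open>w k\<close> and cancels the weight.\<close>

lemma unit_coord_powr: "norm (a * complex_of_real (w k powr (- 1 / p))) powr p * w k = norm a powr p"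
  using w[of k] p_pos by (simp add: norm_mult norm_divide powr_mult powr_divide powr_powr powr_minus_divide)

lemma sum_unit_apply:
  "(\<Sum>k<N. seq_scale (c k) (unit k)) j =
    (if j < N then c j * complex_of_real (w j powr (- 1 / p)) else 0)"
  by (simp add: sum_fun_apply seq_scale_def unit_apply if_distrib[of "(*) _"] sum.delta' cong: if_cong)

text \<open>Coordinates from \<open>N\<close> on vanish, so the series is a finite sum in which all
  weights cancel. The equality of norms gives both Riesz bounds with constant 1.\<close>

lemma
  shows sum_unit_in_carrier: "(\<Sum>k<N. seq_scale (c k) (unit k)) \<in> V"
    and nrm_sum_unit: "nrm (\<Sum>k<N. seq_scale (c k) (unit k)) = (\<Sum>k<N. norm (c k) powr p) powr (1 / p)"
proof -
  have "(\<lambda>j. norm ((\<Sum>k<N. seq_scale (c k) (unit k)) j) powr p * w j)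
      sums (\<Sum>j<N. norm ((\<Sum>k<N. seq_scale (c k) (unit k)) j) powr p * w j)"
    by (rule sums_finite) (auto simp: sum_unit_apply)
  also have "(\<Sum>j<N. norm ((\<Sum>k<N. seq_scale (c k) (unit k)) j) powr p * w j) = (\<Sum>j<N. norm (c j) powr p)"
    by (intro sum.cong) (simp_all only: sum_unit_apply lessThan_iff if_True unit_coord_powr)
  finally have s: "(\<lambda>j. norm ((\<Sum>k<N. seq_scale (c k) (unit k)) j) powr p * w j)
      sums (\<Sum>j<N. norm (c j) powr p)" .
  show "(\<Sum>k<N. seq_scale (c k) (unit k)) \<in> V"
    using s by (simp add: mem_iff sums_iff)
  show "nrm (\<Sum>k<N. seq_scale (c k) (unit k)) = (\<Sum>k<N. norm (c k) powr p) powr (1 / p)"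
    unfolding weighted_lp_norm_def using s by (simp add: sums_iff)
qed

lemma
  shows unit_in_carrier: "unit k \<in> V" and nrm_unit: "nrm (unit k) = 1"
proof -
  \<comment> \<open>A single basis vector is a combination of length \<open>Suc k\<close> with only
    the last coefficient nonzero, so the preceding norm formula covers it.\<close>
  have "(\<Sum>j<Suc k. seq_scale (if j = k then 1 else 0) (unit j)) = unit k"
    by (simp add: fun_eq_iff sum_unit_apply unit_apply del: sum.lessThan_Suc)
  moreover have "(\<Sum>j<Suc k. norm (if j = k then 1 else 0 :: complex) powr p) = 1"
    by simp
  ultimately show "unit k \<in> V" "nrm (unit k) = 1"
    using sum_unit_in_carrier[where N = "Suc k" and c = "\<lambda>j. if j = k then 1 else 0"]
      nrm_sum_unit[where N = "Suc k" and c = "\<lambda>j. if j = k then 1 else 0"] by simp_all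
qed

lemma span_unit_subset: "seq.span (range unit) \<subseteq> V"
  by (rule seq.span_minimal) (use unit_in_carrier subspace_carrier in auto)

text \<open>Truncations of \<open>x\<close> lie in the span, and the \<open>p\<close>-th power of
  the error is a tail of a convergent series.\<close>

lemma closure_of_span_unit: "metric.mtopology closure_of seq.span (range unit) = V"
  unfolding closure_of_eq_carrier_iff[OF span_unit_subset]
proof (intro ballI allI impI)
  fix x and r :: real assume x: "x \<in> V" and r: "r > 0"
  have "(\<lambda>n. \<Sum>k. norm (x (k + n)) powr p * w (k + n)) \<longlonglongrightarrow> 0"
    using suminf_exist_split2 x by (simp add: mem_iff)
  moreover have "(r / 2) powr p > 0" using r by simp
  ultimately obtain n where n: "(\<Sum>k. norm (x (k + n)) powr p * w (k + n)) < (r / 2) powr p"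
    by (metis (no_types, lifting) eventually_sequentially order_tendstoD(2) order_refl)
  \<comment> \<open>The truncation of \<open>x\<close> to its first \<open>n\<close> entries: the
    factor \<open>w k powr (1 / p)\<close> undoes the normalisation of
    \<open>unit k\<close>.\<close>
  define y where "y = (\<Sum>k<n. seq_scale (x k * complex_of_real (w k powr (1 / p))) (unit k))"
  have "complex_of_real (w j powr (1 / p)) * complex_of_real (w j powr (- 1 / p)) = 1" for j
    using w[of j] by (simp add: powr_minus_divide flip: of_real_mult)
  then have y: "y j = (if j < n then x j else 0)" for j
    by (simp add: y_def sum_unit_apply mult.assoc)
  have "y \<in> seq.span (range unit)"
    unfolding y_def by (intro seq.span_sum seq.span_scale seq.span_base) auto
  moreover have "nrm (x - y) \<le> r / 2"
  proof (rule nrm_leI)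
    fix m
    \<comment> \<open>Adding \<open>n\<close> terms leaves exactly \<open>m\<close> terms of the
      tail once the first \<open>n\<close>, which are zero, are dropped.\<close>
    have "(\<Sum>k<m. norm ((x - y) k) powr p * w k) \<le> (\<Sum>k<m + n. norm ((x - y) k) powr p * w k)"
      by (rule sum_mono2) auto
    also have "\<dots> = (\<Sum>k=n..<m + n. norm (x k) powr p * w k)"
      by (rule sum.mono_neutral_cong_right) (auto simp: y)
    also have "\<dots> = (\<Sum>k<m. norm (x (k + n)) powr p * w (k + n))"
      using sum.shift_bounds_nat_ivl[of _ 0 n m] by (simp add: atLeast0LessThan)
    also have "\<dots> \<le> (\<Sum>k. norm (x (k + n)) powr p * w (k + n))"
      using x summable_ignore_initial_segment[of "\<lambda>k. norm (x k) powr p * w k" n]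
      by (intro sum_le_suminf) (auto simp: mem_iff)
    finally show "(\<Sum>k<m. norm ((x - y) k) powr p * w k) \<le> (r / 2) powr p" using n by simp
  qed (use r in simp)
  ultimately show "\<exists>y\<in>seq.span (range unit). nrm (x - y) < r"
    using r by (intro bexI[of _ y]) auto
qed

sublocale p_riesz_basis seq_scale V nrm p unit 1 1
  by unfold_locales
    (auto simp: p unit_in_carrier closure_of_span_unit nrm_sum_unit)

section \<open>Explicit extensions of the shifts and their norms\<close>

definition left_shift :: "(nat \<Rightarrow> complex) \<Rightarrow> nat \<Rightarrow> complex" where
  "left_shift c k = c (Suc k) * complex_of_real (w (Suc k) powr (1 / p)) * complex_of_real (w k powr (- 1 / p))"

definition right_shift :: "(nat \<Rightarrow> complex) \<Rightarrow> nat \<Rightarrow> complex" where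
  "right_shift c k = (case k of 0 \<Rightarrow> 0 | Suc j \<Rightarrow>
     c j * complex_of_real (w j powr (1 / p)) * complex_of_real (w k powr (- 1 / p)))"

text \<open>The first factor turns an entry in position \<open>j\<close> into the coefficient along
  \<open>unit j\<close>; the second turns that coefficient into an entry in position
  \<open>k\<close>. Moving coefficients this way preserves each weighted term.\<close>

lemma coord_powr: "norm (a * complex_of_real (w j powr (1 / p)) * complex_of_real (w k powr (- 1 / p))) powr p * w k
    = norm a powr p * w j"
  unfolding unit_coord_powr using w[of j] p_pos by (simp add: norm_mult powr_mult powr_powr)

lemma
  assumes "c \<in> V"
  shows left_shift_in_carrier: "left_shift c \<in> V" and nrm_left_shift: "nrm (left_shift c) \<le> nrm c"
proof -
  have "(\<Sum>k<n. norm (left_shift c k) powr p * w k) \<le> nrm c powr p" for n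
  proof -
    have "(\<Sum>k<n. norm (left_shift c k) powr p * w k) = (\<Sum>k<n. norm (c (Suc k)) powr p * w (Suc k))"
      unfolding left_shift_def coord_powr ..
    \<comment> \<open>Reindexing shows a partial sum for \<open>c\<close> without the term at index
      0, hence an inequality rather than an equality of norms.\<close>
    also have "\<dots> = (\<Sum>k\<in>Suc ` {..<n}. norm (c k) powr p * w k)"
      by (simp add: sum.reindex)
    also have "\<dots> \<le> nrm c powr p" using assms by (rule sum_term_le_nrm) simp
    finally show ?thesis .
  qed
  from nrm_leI[OF nrm_ge_0 this]
  show "left_shift c \<in> V" "nrm (left_shift c) \<le> nrm c" .
qed

lemma
  assumes "c \<in> V"
  shows right_shift_in_carrier: "right_shift c \<in> V" and nrm_right_shift: "nrm (right_shift c) \<le> nrm c"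
proof -
  have "(\<Sum>k<n. norm (right_shift c k) powr p * w k) \<le> nrm c powr p" for n
  proof -
    \<comment> \<open>One extra term is added so that, after the zero entry at index 0 is split off,
      exactly \<open>n\<close> terms of \<open>c\<close> remain.\<close>
    have "(\<Sum>k<n. norm (right_shift c k) powr p * w k) \<le> (\<Sum>k<Suc n. norm (right_shift c k) powr p * w k)"
      by simp
    also have "\<dots> = (\<Sum>k<n. norm (right_shift c (Suc k)) powr p * w (Suc k))"
      unfolding sum.lessThan_Suc_shift by (simp add: right_shift_def)
    also have "\<dots> = (\<Sum>k<n. norm (c k) powr p * w k)"
      unfolding right_shift_def nat.case coord_powr ..
    also have "\<dots> \<le> nrm c powr p" using assms by (rule sum_term_le_nrm) simp
    finally show ?thesis .
  qed
  from nrm_leI[OF nrm_ge_0 this]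
  show "right_shift c \<in> V" "nrm (right_shift c) \<le> nrm c" .
qed

lemma linear_left_shift: "linear_map_on V left_shift"
  using left_shift_in_carrier
  by (auto simp: linear_map_on_def left_shift_def seq_scale_def fun_eq_iff algebra_simps)

lemma linear_right_shift: "linear_map_on V right_shift"
  using right_shift_in_carrier
  by (auto simp: linear_map_on_def right_shift_def seq_scale_def fun_eq_iff algebra_simps split: nat.split)

lemma left_shift_unit: "left_shift (unit 0) = 0" "left_shift (unit (Suc k)) = unit k"
  using w[of "Suc k"]
  by (auto simp: fun_eq_iff left_shift_def unit_apply powr_minus_divide simp flip: of_real_mult)

lemma right_shift_unit: "right_shift (unit k) = unit (Suc k)"
  using w[of k]
  by (auto simp: fun_eq_iff right_shift_def unit_apply powr_minus_divide simp flip: of_real_mult split: nat.split)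

text \<open>With its counterpart for the right shift, this supplies the existence claims, so the
  statements about every \<open>L\<close> and \<open>R\<close> are not vacuous.\<close>

lemma is_left_shift_left_shift: "is_left_shift unit left_shift"
  using linear_map_on_subset[OF linear_left_shift span_unit_subset] left_shift_unit
  by (simp add: is_left_shift_def)

lemma is_right_shift_right_shift: "is_right_shift unit right_shift"
  using linear_map_on_subset[OF linear_right_shift span_unit_subset] right_shift_unit
  by (simp add: is_right_shift_def)

text \<open>A left shift is determined on the span by its values on the basis, so it agrees there
  with \<open>left_shift\<close>, which is a contraction attaining norm 1.\<close>

lemma left_shift_extends:
  assumes "is_left_shift unit L"
  shows "extends_boundedly_with_norm (seq.span (range unit)) L 1"
proof (rule extends_boundedly_with_normI[OF _ _ _ span_unit_subset closure_of_span_unit])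
  show "bounded_operator left_shift"
    using linear_left_shift nrm_left_shift by (auto simp: bounded_operator_def intro!: exI[of _ 1])
  show "left_shift x = L x" if x: "x \<in> seq.span (range unit)" for x
  proof (rule linear_map_on_eq_on_span[OF _ _ _ x])
    show "left_shift b = L b" if b: "b \<in> range unit" for b
    proof -
      obtain k where "b = unit k" using b by blast
      then show ?thesis
        using assms left_shift_unit by (cases k) (simp_all add: is_left_shift_def)
    qed
  qed (use assms is_left_shift_left_shift in \<open>auto simp: is_left_shift_def\<close>)
  show "operator_norm left_shift = 1"
    \<comment> \<open>The norm is attained at the second basis vector, since the first is sent to
      0.\<close>
    by (rule operator_norm_eq_1[of _ "unit (Suc 0)"])
      (auto simp: nrm_left_shift unit_in_carrier nrm_unit left_shift_unit)
qed

lemma right_shift_extends: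
  assumes "is_right_shift unit R"
  shows "extends_boundedly_with_norm (seq.span (range unit)) R 1"
proof (rule extends_boundedly_with_normI[OF _ _ _ span_unit_subset closure_of_span_unit])
  show "bounded_operator right_shift"
    using linear_right_shift nrm_right_shift by (auto simp: bounded_operator_def intro!: exI[of _ 1])
  show "right_shift x = R x" if x: "x \<in> seq.span (range unit)" for x
    by (rule linear_map_on_eq_on_span[OF _ _ _ x])
      (use assms is_right_shift_right_shift in \<open>auto simp: is_right_shift_def\<close>)
  show "operator_norm right_shift = 1"
    by (rule operator_norm_eq_1[of _ "unit 0"])
      (auto simp: nrm_right_shift unit_in_carrier nrm_unit right_shift_unit)
qed

end

theorem corollary1p5:
  fixes p :: real and w :: "nat \<Rightarrow> real" and e :: "nat \<Rightarrow> nat \<Rightarrow> complex"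
  assumes "1 \<le> p"
    and "\<And>k. 0 < w k"
    and "\<And>k. e k = seq_scale (complex_of_real (w k powr (- 1 / p))) (delta k)"
  shows "p_riesz_basis seq_scale (weighted_lp p w) (weighted_lp_norm p w) p e 1 1 \<and>
    (\<exists>L. complex_normed_space.is_left_shift seq_scale (weighted_lp p w) e L) \<and>
    (\<forall>L. complex_normed_space.is_left_shift seq_scale (weighted_lp p w) e L \<longrightarrow>
      complex_normed_space.extends_boundedly_with_norm seq_scale
        (weighted_lp p w) (weighted_lp_norm p w) (module.span seq_scale (range e)) L 1) \<and>
    (\<exists>R. complex_normed_space.is_right_shift seq_scale (weighted_lp p w) e R) \<and>
    (\<forall>R. complex_normed_space.is_right_shift seq_scale (weighted_lp p w) e R \<longrightarrow>
      complex_normed_space.extends_boundedly_with_norm seq_scale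
        (weighted_lp p w) (weighted_lp_norm p w) (module.span seq_scale (range e)) R 1)"
proof -
  interpret weighted_lp_space p w
    using assms(1,2) by unfold_locales
  have "e = unit" using assms(3) by (auto simp: unit_def)
  then show ?thesis
    using p_riesz_basis_axioms is_left_shift_left_shift is_right_shift_right_shift
      left_shift_extends right_shift_extends by blast
qed

end
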